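(* The satisfaction system $\Lambda_X$ of the NeXt fragment of LTL is reception-compatible but not eviction-compatible.
   Context: Fix a non-empty set $\mathcal{P}$ of propositional atoms. $\Lambda_X=(\mathcal{L}_X,\mathfrak{M}_X,\models_X)$, where $\mathcal{L}_X$ is given by $\varphi::=p\mid X\varphi$ with $p\in\mathcal{P}$ (so every formula is $X^np$, $n\ge0$). A Kripke structure is $M=(S,R,\lambda)$ with $S$ a non-empty finite set of states, $R\subseteq S\times S$ total (every state has a successor), $\lambda:S\to\mathcal{P}(\mathcal{P})$. $\mathfrak{M}_X$ is the set of pairs $(M,s)$ with $M$ a Kripke structure and $s$ a state of $M$. $(M,s)\models_X X^ip$ iff for every path $s_0s_1\ldots$ in $M$ with $s_0=s$, $p\in\lambda(s_i)$; $(M,s)\models_X B$ iff it satisfies every formula in $B$. For a satisfaction system $\Lambda=(\mathcal{L},\mathfrak{M},\models)$: $\mathrm{Mod}(B)=\{m\in\mathfrak{M}\mid m\models B\}$; $\mathrm{FR}(\Lambda)=\{\mathrm{Mod}(B)\mid B\subseteq\mathcal{L}$ finite$\}$; $\mathrm{FRsubs}(\mathbb{M},\Lambda)$ is the set of $\subseteq$-maximal elements of $\{Y\in\mathrm{FR}(\Lambda)\mid Y\subseteq\mathbb{M}\}$ and $\mathrm{FRsups}(\mathbb{M},\Lambda)$ the set of $\subseteq$-minimal elements of $\{Y\in\mathrm{FR}(\Lambda)\mid\mathbb{M}\subseteq Y\}$. $\Lambda$ is eviction-compatible if $\mathrm{FRsubs}(\mathrm{Mod}(B)\setminus\mathbb{M},\Lambda)\neq\emptyset$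 for all finite $B\subseteq\mathcal{L}$ and $\mathbb{M}\subseteq\mathfrak{M}$; it is reception-compatible if $\mathrm{FRsups}(\mathrm{Mod}(B)\cup\mathbb{M},\Lambda)\neq\emptyset$ for all finite $B$ and $\mathbb{M}$. *)

theory Defs
  imports Main "HOL-Library.FuncSet"
begin

section \<open>Satisfaction systems\<close>

text \<open>Satisfaction relates a model to a set of formulas, not to a single formula.\<close>

record ('f, 'm) sat_system =
  lang :: "'f set"
  models :: "'m set"
  sat :: "'m \<Rightarrow> 'f set \<Rightarrow> bool"

definition Mod :: "('f, 'm) sat_system \<Rightarrow> 'f set \<Rightarrow> 'm set" where
  "Mod \<Lambda> B = {m \<in> models \<Lambda>. sat \<Lambda> m B}"

definition FR :: "('f, 'm) sat_system \<Rightarrow> 'm set set" where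
  "FR \<Lambda> = {Mod \<Lambda> B | B. B \<subseteq> lang \<Lambda> \<and> finite B}"

definition FRsubs :: "'m set \<Rightarrow> ('f, 'm) sat_system \<Rightarrow> 'm set set" where
  "FRsubs \<MM> \<Lambda> = {Y \<in> FR \<Lambda>. Y \<subseteq> \<MM> \<and> \<not> (\<exists>Z \<in> FR \<Lambda>. Z \<subseteq> \<MM> \<and> Y \<subset> Z)}"

definition FRsups :: "'m set \<Rightarrow> ('f, 'm) sat_system \<Rightarrow> 'm set set" where
  "FRsups \<MM> \<Lambda> = {Y \<in> FR \<Lambda>. \<MM> \<subseteq> Y \<and> \<not> (\<exists>Z \<in> FR \<Lambda>. \<MM> \<subseteq> Z \<and> Z \<subset> Y)}"

definition eviction_compatible :: "('f, 'm) sat_system \<Rightarrow> bool" where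
  "eviction_compatible \<Lambda> \<longleftrightarrow>
     (\<forall>B \<MM>. B \<subseteq> lang \<Lambda> \<and> finite B \<and> \<MM> \<subseteq> models \<Lambda> \<longrightarrow> FRsubs (Mod \<Lambda> B - \<MM>) \<Lambda> \<noteq> {})"

definition reception_compatible :: "('f, 'm) sat_system \<Rightarrow> bool" where
  "reception_compatible \<Lambda> \<longleftrightarrow>
     (\<forall>B \<MM>. B \<subseteq> lang \<Lambda> \<and> finite B \<and> \<MM> \<subseteq> models \<Lambda> \<longrightarrow> FRsups (Mod \<Lambda> B \<union> \<MM>) \<Lambda> \<noteq> {})"

section \<open>The NeXt fragment of LTL\<close>

text \<open>The non-empty set of atoms is the universe of the type \<open>'p\<close>.\<close>

datatype 'p xformula = Atom 'p | Next "'p xformula"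

text \<open>Every formula is \<open>X^i p\<close> for a unique \<open>i\<close>, its depth, and a unique atom \<open>p\<close>.\<close>

primrec xdepth :: "'p xformula \<Rightarrow> nat" where
  "xdepth (Atom p) = 0"
| "xdepth (Next \<phi>) = Suc (xdepth \<phi>)"

primrec xatom :: "'p xformula \<Rightarrow> 'p" where
  "xatom (Atom p) = p"
| "xatom (Next \<phi>) = xatom \<phi>"

lemma xformula_eq_Next_pow: "\<phi> = (Next ^^ xdepth \<phi>) (Atom (xatom \<phi>))"
  by (induction \<phi>) auto

lemma xdepth_Next_pow [simp]: "xdepth ((Next ^^ i) (Atom p)) = i"
  by (induction i) auto

lemma xatom_Next_pow [simp]: "xatom ((Next ^^ i) (Atom p)) = p"
  by (induction i) auto

record ('s, 'p) kripke =
  states :: "'s set"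
  step :: "('s \<times> 's) set"
  label :: "'s \<Rightarrow> 'p set"

text \<open>The labelling is a function on the states only, hence extensional: its value
  outside the set of states is fixed, so that it does not distinguish structures.\<close>

definition kripke_structure :: "('s, 'p) kripke \<Rightarrow> bool" where
  "kripke_structure M \<longleftrightarrow>
     states M \<noteq> {} \<and> finite (states M) \<and>
     step M \<subseteq> states M \<times> states M \<and>
     (\<forall>s \<in> states M. \<exists>t. (s, t) \<in> step M) \<and>
     label M \<in> extensional (states M)"

definition path :: "('s, 'p) kripke \<Rightarrow> (nat \<Rightarrow> 's) \<Rightarrow> bool" where
  "path M \<pi> \<longleftrightarrow> (\<forall>i. \<pi> i \<in> states M \<and> (\<pi> i, \<pi> (Suc i)) \<in> step M)"

definition sat_X :: "('s, 'p) kripke \<times> 's \<Rightarrow> 'p xformula \<Rightarrow> bool" where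
  "sat_X m \<phi> \<longleftrightarrow>
     (\<forall>\<pi>. path (fst m) \<pi> \<and> \<pi> 0 = snd m \<longrightarrow> xatom \<phi> \<in> label (fst m) (\<pi> (xdepth \<phi>)))"

lemma sat_X_Next_pow:
  "sat_X (M, s) ((Next ^^ i) (Atom p)) \<longleftrightarrow>
     (\<forall>\<pi>. path M \<pi> \<and> \<pi> 0 = s \<longrightarrow> p \<in> label M (\<pi> i))"
  by (simp add: sat_X_def)

text \<open>States are drawn from the type \<open>'s\<close>; when it is infinite, every finite Kripke structure
  occurs here up to isomorphism.\<close>

definition Lambda_X :: "('p xformula, ('s, 'p) kripke \<times> 's) sat_system" where
  "Lambda_X = \<lparr>lang = UNIV,
               models = {(M, s). kripke_structure M \<and> s \<in> states M},
               sat = (\<lambda>m B. \<forall>\<phi> \<in> B. sat_X m \<phi>)\<rparr>"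

end

theory Submission
  imports Defs
begin

text \<open>Every formula \<open>\<psi>\<close> is falsified by a lasso-shaped structure with a single path that satisfies
  all other formulas. Hence a formula holding throughout \<open>Mod B\<close> belongs to \<open>B\<close>. The formulas of \<open>B\<close> that also hold throughout \<open>\<MM>\<close> therefore define the
  least finitely representable superset of \<open>Mod B \<union> \<MM>\<close>. The same structures show that every finite
  set of formulas has a model, so the empty set of models, which results from evicting all models,
  has no finitely representable subset.\<close>

lemma xformula_eq_iff: "\<phi> = \<psi> \<longleftrightarrow> xdepth \<phi> = xdepth \<psi> \<and> xatom \<phi> = xatom \<psi>"
  by (metis xformula_eq_Next_pow)

text \<open>Depth alone takes every natural number as value, so a single atom suffices.\<close>

lemma infinite_UNIV_xformula: "infinite (UNIV :: 'p xformula set)"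
proof
  assume "finite (UNIV :: 'p xformula set)"
  then have "finite (range (xdepth :: 'p xformula \<Rightarrow> nat))"
    by simp
  moreover have "range (xdepth :: 'p xformula \<Rightarrow> nat) = UNIV"
    by (rule surjI, rule xdepth_Next_pow)
  ultimately show False
    by simp
qed

lemma mem_models_Lambda_X:
  "(M, s) \<in> models Lambda_X \<longleftrightarrow> kripke_structure M \<and> s \<in> states M"
  by (simp add: Lambda_X_def)

lemma mem_Mod_Lambda_X:
  "m \<in> Mod Lambda_X B \<longleftrightarrow> m \<in> models Lambda_X \<and> (\<forall>\<phi>\<in>B. sat_X m \<phi>)"
  by (simp add: Mod_def Lambda_X_def)

lemma FR_Lambda_X: "FR Lambda_X = {Mod Lambda_X B | B. finite B}"
  by (simp add: FR_def Lambda_X_def)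

text \<open>The structure is a line \<open>f 0\<close>, ..., \<open>f n\<close> with a loop at
  \<open>f n\<close>. Its only path from \<open>f 0\<close> is in \<open>f (min j n)\<close> at time
  j, so a single label decides each formula. Only the label of \<open>f (xdepth \<psi>)\<close> is
  not full: it lacks exactly \<open>xatom \<psi>\<close>.\<close>

lemma ex_model_falsifying_only:
  fixes \<psi> :: "'p xformula"
  assumes "infinite (UNIV :: 's set)"
  obtains m :: "('s, 'p) kripke \<times> 's"
  where "m \<in> models Lambda_X" "\<And>\<phi>. sat_X m \<phi> \<longleftrightarrow> \<phi> \<noteq> \<psi>"
proof -
  obtain f :: "nat \<Rightarrow> 's" where inj: "inj f"
    using assms infinite_countable_subset by blast
  \<comment> \<open>The loop lies one step past the depth of \<psi>, so the defective state is
    visited only once. A loop at \<open>f (xdepth \<psi>)\<close> would also falsify all deeper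
    formulas with the same atom.\<close>
  define n where "n = Suc (xdepth \<psi>)"
  define M :: "('s, 'p) kripke" where
    "M = \<lparr>states = f ` {..n}, step = (\<lambda>j. (f j, f (min (Suc j) n))) ` {..n},
      label = restrict (\<lambda>x. if x = f (xdepth \<psi>) then - {xatom \<psi>} else UNIV) (f ` {..n})\<rparr>"
  have states: "states M = f ` {..n}"
    and step: "step M = (\<lambda>j. (f j, f (min (Suc j) n))) ` {..n}"
    by (simp_all add: M_def)
  have label: "p \<in> label M (f j) \<longleftrightarrow> j \<noteq> xdepth \<psi> \<or> p \<noteq> xatom \<psi>" if "j \<le> n" for p j
    using that inj by (auto simp: M_def inj_eq)
  have kripke: "kripke_structure M"
    unfolding kripke_structure_def states step by (auto simp: M_def)
  have is_path: "path M (\<lambda>j. f (min j n))"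
    unfolding path_def states step
  proof (intro allI conjI)
    fix j
    \<comment> \<open>This identity treats the steps along the line and the loop at
      \<open>f n\<close> at once.\<close>
    have "min (Suc j) n = min (Suc (min j n)) n"
      by linarith
    then show "(f (min j n), f (min (Suc j) n)) \<in> (\<lambda>j. (f j, f (min (Suc j) n))) ` {..n}"
      by (intro image_eqI[where x = "min j n"]) simp_all
  qed simp
  have path_unique: "\<pi> j = f (min j n)" if "path M \<pi>" "\<pi> 0 = f 0" for \<pi> j
  proof (induction j)
    case 0
    show ?case using that by simp
  next
    case (Suc j)
    from that(1) have "(\<pi> j, \<pi> (Suc j)) \<in> step M"
      by (simp add: path_def)
    then obtain k where "k \<le> n" "f (min j n) = f k" "\<pi> (Suc j) = f (min (Suc k) n)"
      by (auto simp: step Suc)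
    \<comment> \<open>Injectivity of \<open>f\<close> recovers the index from the state, which
      determines the successor.\<close>
    moreover from this have "min j n = k"
      using inj by (simp add: inj_eq)
    ultimately show ?case
      by (auto simp: min_def not_less_eq_eq le_Suc_eq)
  qed
  have "sat_X (M, f 0) \<phi> \<longleftrightarrow> \<phi> \<noteq> \<psi>" for \<phi>
  proof -
    have "sat_X (M, f 0) \<phi> \<longleftrightarrow> xatom \<phi> \<in> label M (f (min (xdepth \<phi>) n))"
    proof
      assume "sat_X (M, f 0) \<phi>"
      with is_path show "xatom \<phi> \<in> label M (f (min (xdepth \<phi>) n))"
        unfolding sat_X_def by (auto dest!: spec[where x = "\<lambda>j. f (min j n)"])
    next
      assume "xatom \<phi> \<in> label M (f (min (xdepth \<phi>) n))"
      then show "sat_X (M, f 0) \<phi>"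
        unfolding sat_X_def by (simp add: path_unique)
    qed
    also have "\<dots> \<longleftrightarrow> \<phi> \<noteq> \<psi>"
      by (auto simp: label xformula_eq_iff[of \<phi>] n_def min_def)
    finally show ?thesis .
  qed
  moreover have "(M, f 0) \<in> models Lambda_X"
    by (simp add: mem_models_Lambda_X kripke states)
  ultimately show thesis
    by (rule that[rotated])
qed

text \<open>If \<psi> is not in \<open>B\<close>, the structure falsifying \<psi> alone is a model
  of \<open>B\<close> that refutes the left side.\<close>

lemma Mod_Lambda_X_entails_iff:
  fixes B :: "'p xformula set"
  assumes "infinite (UNIV :: 's set)"
  shows "(\<forall>m \<in> Mod (Lambda_X :: ('p xformula, ('s, 'p) kripke \<times> 's) sat_system) B. sat_X m \<psi>)
    \<longleftrightarrow> \<psi> \<in> B"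
  by (rule ex_model_falsifying_only[OF assms, of \<psi>]) (metis mem_Mod_Lambda_X)

text \<open>Some formula lies outside the finite set \<open>B\<close>; the model of \<open>B\<close>
  that falsifies it is the required element.\<close>

lemma Mod_Lambda_X_nonempty:
  fixes B :: "'p xformula set"
  assumes "infinite (UNIV :: 's set)" and "finite B"
  shows "Mod (Lambda_X :: ('p xformula, ('s, 'p) kripke \<times> 's) sat_system) B \<noteq> {}"
  using Mod_Lambda_X_entails_iff[OF assms(1), of B] ex_new_if_finite[OF infinite_UNIV_xformula assms(2)]
  by blast

lemma reception_compatible_Lambda_X:
  assumes "infinite (UNIV :: 's set)"
  shows "reception_compatible (Lambda_X :: ('p xformula, ('s, 'p) kripke \<times> 's) sat_system)"
    (is "reception_compatible ?L")
  unfolding reception_compatible_def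
proof (intro allI impI)
  fix B :: "'p xformula set" and \<MM> :: "(('s, 'p) kripke \<times> 's) set"
  assume B: "B \<subseteq> lang ?L \<and> finite B \<and> \<MM> \<subseteq> models ?L"
  \<comment> \<open>Whatever holds throughout \<open>Mod ?L B\<close> is already in
    \<open>B\<close>, so \<open>C\<close> is the full theory of
    \<open>Mod ?L B \<union> \<MM>\<close>, and it is finite.\<close>
  define C where "C = {\<phi> \<in> B. \<forall>m\<in>\<MM>. sat_X m \<phi>}"
  have "Mod ?L B \<union> \<MM> \<subseteq> Mod ?L C"
    using B by (auto simp: C_def mem_Mod_Lambda_X)
  moreover have "Mod ?L C \<subseteq> Mod ?L D" if "Mod ?L B \<union> \<MM> \<subseteq> Mod ?L D" for D
  proof -
    \<comment> \<open>Thus \<open>D\<close> is contained in \<open>C\<close>. As \<open>Mod\<close>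
      reverses inclusions, \<open>Mod ?L C\<close> is even least, not just minimal.\<close>
    have "\<phi> \<in> C" if "\<phi> \<in> D" for \<phi>
      using that \<open>Mod ?L B \<union> \<MM> \<subseteq> Mod ?L D\<close> Mod_Lambda_X_entails_iff[OF assms, of B \<phi>]
      unfolding C_def by (auto simp: mem_Mod_Lambda_X subset_iff)
    then show ?thesis
      by (auto simp: mem_Mod_Lambda_X)
  qed
  moreover have "Mod ?L C \<in> FR ?L"
    using B by (auto simp: FR_Lambda_X C_def)
  ultimately have "Mod ?L C \<in> FRsups (Mod ?L B \<union> \<MM>) ?L"
    unfolding FRsups_def by (auto simp: FR_Lambda_X)
  then show "FRsups (Mod ?L B \<union> \<MM>) ?L \<noteq> {}"
    by blast
qed

lemma not_eviction_compatible_Lambda_X: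
  assumes "infinite (UNIV :: 's set)"
  shows "\<not> eviction_compatible (Lambda_X :: ('p xformula, ('s, 'p) kripke \<times> 's) sat_system)"
    (is "\<not> eviction_compatible ?L")
proof
  assume "eviction_compatible ?L"
  then have "FRsubs (Mod ?L {} - models ?L) ?L \<noteq> {}"
    by (simp add: eviction_compatible_def)
  moreover have "Mod ?L {} - models ?L = {}"
    by (auto simp: Mod_def)
  \<comment> \<open>A member of \<open>FRsubs {} ?L\<close> can only be the empty set, yet it is
    \<open>Mod\<close> of some finite set.\<close>
  ultimately obtain B where "finite B" "Mod ?L B = {}"
    by (auto simp: FRsubs_def FR_Lambda_X)
  then show False
    using Mod_Lambda_X_nonempty[OF assms] by blast
qed

theorem theorem8:
  assumes "infinite (UNIV :: 's set)"
  shows "reception_compatible (Lambda_X :: ('p xformula, ('s, 'p) kripke \<times> 's) sat_system) \<and>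
         \<not> eviction_compatible (Lambda_X :: ('p xformula, ('s, 'p) kripke \<times> 's) sat_system)"
  using reception_compatible_Lambda_X[OF assms] not_eviction_compatible_Lambda_X[OF assms] by blast

end
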